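(* Let $g \colon \mathbb{R}^n \to \mathbb{R}$ be a convex function, let $S = \{ x \in \mathbb{R}^n : g(x) \le 0 \}$ with $S \neq \emptyset$, and let $\bar{x} \in \mathbb{R}^n$ with $\bar{x} \notin S$. There exists a subgradient $v \in \partial g(\bar{x})$ such that the valid inequality $$g(\bar{x}) + v^T (x - \bar{x}) \le 0$$ supports $S$ if and only if there exists $x_0 \in S$ such that the function $\lambda \mapsto g(x_0 + \lambda(\bar{x} - x_0))$ is affine on $[0,1]$.
   Context: The subdifferential of a convex function $g$ at $\bar{x}$ is $\partial g(\bar{x}) = \{ v \in \mathbb{R}^n : g(\bar{x}) + v^T(x - \bar{x}) \le g(x) \text{ for all } x \in \mathbb{R}^n \}$, and its elements are called subgradients. A linear inequality $\alpha^T x \le \beta$ is valid for a set $S$ if every $x \in S$ satisfies it. A valid inequality $\alpha^T x \le \beta$ supports $S$ if there is a point $x \in \partial S$ (the topological boundary of $S$) with $\alpha^T x = \beta$. *)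

theory Defs
  imports "HOL-Analysis.Analysis"
begin

definition subdifferential :: "(real ^ 'n \<Rightarrow> real) \<Rightarrow> real ^ 'n \<Rightarrow> (real ^ 'n) set" where
  "subdifferential g xb = {v. \<forall>x. g xb + v \<bullet> (x - xb) \<le> g x}"

text \<open>A linear inequality \<open>\<alpha> \<bullet> x \<le> \<beta>\<close> is represented by the pair of its data \<open>\<alpha>\<close> and \<open>\<beta>\<close>.\<close>

definition valid_ineq :: "real ^ 'n \<Rightarrow> real \<Rightarrow> (real ^ 'n) set \<Rightarrow> bool" where
  "valid_ineq \<alpha> \<beta> S \<longleftrightarrow> (\<forall>x\<in>S. \<alpha> \<bullet> x \<le> \<beta>)"

definition supports_set :: "real ^ 'n \<Rightarrow> real \<Rightarrow> (real ^ 'n) set \<Rightarrow> bool" where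
  "supports_set \<alpha> \<beta> S \<longleftrightarrow> valid_ineq \<alpha> \<beta> S \<and> (\<exists>x\<in>frontier S. \<alpha> \<bullet> x = \<beta>)"

definition affine_fun_on :: "real set \<Rightarrow> (real \<Rightarrow> real) \<Rightarrow> bool" where
  "affine_fun_on I f \<longleftrightarrow> (\<exists>a b. \<forall>t\<in>I. f t = a * t + b)"

text \<open>
  The inequality \<open>g xb + v \<bullet> (x - xb) \<le> 0\<close> in the unknown \<open>x\<close> has, in the form \<open>\<alpha> \<bullet> x \<le> \<beta>\<close>,
  the normal vector \<open>\<alpha> = v\<close> and the following right-hand side \<open>\<beta>\<close>.
\<close>

definition subgradient_rhs :: "(real ^ 'n \<Rightarrow> real) \<Rightarrow> real ^ 'n \<Rightarrow> real ^ 'n \<Rightarrow> real" where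
  "subgradient_rhs g xb v = v \<bullet> xb - g xb"

lemma subgradient_ineq_iff:
  "v \<bullet> x \<le> subgradient_rhs g xb v \<longleftrightarrow> g xb + v \<bullet> (x - xb) \<le> 0"
  by (auto simp: subgradient_rhs_def inner_diff_right)

end

theory Submission
  imports Defs
begin

text \<open>
  If the inequality of a subgradient \<open>v\<close> is tight at \<open>x0 \<in> S\<close>, then \<open>g x0 = 0\<close>, and on the segment
  from \<open>x0\<close> to \<open>xb\<close> the convexity bound and the subgradient bound coincide. Conversely, if \<open>g\<close> is
  affine on such a segment, it has a zero \<open>x1\<close> there. A subgradient of \<open>g\<close> at the midpoint of \<open>x1\<close>
  and \<open>xb\<close> gives an affine minorant that touches \<open>g\<close> in the interior of a segment on which \<open>g\<close> is
  affine, hence on the whole segment; so it is a subgradient at \<open>xb\<close> with equality at \<open>x1\<close>.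
\<close>

text \<open>A hyperplane separating the point \<open>(m, g m)\<close> from the strict epigraph of
  \<open>g\<close> is not vertical, because \<open>g\<close> is finite everywhere; its slope is a
  subgradient at \<open>m\<close>.\<close>

lemma convex_on_subgradient_exists:
  fixes g :: "'a::euclidean_space \<Rightarrow> real"
  assumes "convex_on UNIV g"
  shows "\<exists>v. \<forall>x. g m + v \<bullet> (x - m) \<le> g x"
proof -
  define E where "E = {z::'a \<times> real. g (fst z) < snd z}"
  have "convex E"
  proof (rule convexI)
    fix p q and s t :: real
    assume *: "p \<in> E" "q \<in> E" "0 \<le> s" "0 \<le> t" "s + t = 1"
    have "g (s *\<^sub>R fst p + t *\<^sub>R fst q) \<le> s * g (fst p) + t * g (fst q)"
      using assms * unfolding convex_on_def by blast
    also have "\<dots> < s * snd p + t * snd q"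
    \<comment> \<open>Strictness must come from a point with positive weight: from \<open>q\<close>
      if \<open>s = 0\<close>, otherwise from \<open>p\<close>.\<close>
    proof (cases "s = 0")
      case True
      with * show ?thesis by (simp add: E_def)
    next
      case False
      with * have "s * g (fst p) < s * snd p" "t * g (fst q) \<le> t * snd q"
        by (auto simp: E_def intro!: mult_left_mono)
      then show ?thesis by linarith
    qed
    finally show "s *\<^sub>R p + t *\<^sub>R q \<in> E"
      by (simp add: E_def)
  qed
  moreover have "(m, g m + 1) \<in> E" "{(m, g m)} \<inter> E = {}"
    by (auto simp: E_def)
  ultimately have "\<exists>a b. a \<noteq> 0 \<and> (\<forall>z\<in>{(m, g m)}. a \<bullet> z \<le> b) \<and> (\<forall>z\<in>E. b \<le> a \<bullet> z)"
    by (intro separating_hyperplane_sets) auto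
  then obtain a b where a: "a \<noteq> 0" "a \<bullet> (m, g m) \<le> b" "\<And>z. z \<in> E \<Longrightarrow> b \<le> a \<bullet> z"
    by blast
  obtain u c where uc: "a = (u, c)" by fastforce
  have sep: "0 \<le> u \<bullet> (x - m) + c * (r - g m)" if "g x < r" for x r
    using a(2) a(3)[of "(x, r)"] that by (simp add: uc E_def inner_diff_right algebra_simps)
  have "c \<ge> 0"
    using sep[of m "g m + 1"] by simp
  moreover have "c \<noteq> 0"
  proof
    assume "c = 0"
    \<comment> \<open>A vertical hyperplane is refuted by moving from \<open>m\<close> against its
      normal \<open>u\<close>.\<close>
    with sep[of "m - u" "g (m - u) + 1"] have "u \<bullet> u \<le> 0" by simp
    then have "u = 0" by (metis inner_gt_zero_iff not_less)
    with \<open>c = 0\<close> a(1) uc show False by (simp add: zero_prod_def)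
  qed
  ultimately have "c > 0" by simp
  have "g m + (- u /\<^sub>R c) \<bullet> (x - m) \<le> g x" for x
  \<comment> \<open>\<open>sep\<close> covers only heights \<open>r\<close> strictly above
    \<open>g x\<close>; the bound at \<open>g x\<close> follows by letting \<open>r\<close> decrease
    to it.\<close>
  proof (rule dense_ge)
    fix r assume "g x < r"
    from sep[OF this] \<open>c > 0\<close> show "g m + (- u /\<^sub>R c) \<bullet> (x - m) \<le> r"
      by (simp add: field_simps)
  qed
  then show ?thesis by blast
qed


text \<open>The affine minorant with slope \<open>v\<close> agrees with \<open>g\<close> at both
  \<open>x\<close> and \<open>y\<close>, so on the segment it is the chord, which convexity makes an
  upper bound as well.\<close>

lemma subgradient_tight_segment:
  fixes g :: "real ^ 'n \<Rightarrow> real"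
  assumes "convex_on UNIV g" and v: "v \<in> subdifferential g y"
    and x: "g x = g y + v \<bullet> (x - y)" and t: "0 \<le> t" "t \<le> 1"
  shows "g (x + t *\<^sub>R (y - x)) = (g y - g x) * t + g x"
proof (rule antisym)
  have eq: "x + t *\<^sub>R (y - x) = (1 - t) *\<^sub>R x + t *\<^sub>R y"
    by (simp add: algebra_simps)
  show "g (x + t *\<^sub>R (y - x)) \<le> (g y - g x) * t + g x"
    using convex_onD[OF assms(1) t, of x y] unfolding eq by (simp add: algebra_simps)
  have "x + t *\<^sub>R (y - x) - y = (1 - t) *\<^sub>R (x - y)"
    by (simp add: algebra_simps)
  then have "v \<bullet> (x + t *\<^sub>R (y - x) - y) = (1 - t) * (g x - g y)"
    using x by simp
  moreover have "g y + v \<bullet> (x + t *\<^sub>R (y - x) - y) \<le> g (x + t *\<^sub>R (y - x))"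
    using v by (auto simp: subdifferential_def)
  ultimately show "(g y - g x) * t + g x \<le> g (x + t *\<^sub>R (y - x))"
    by (simp add: algebra_simps)
qed

lemma subgradient_tight_of_midpoint:
  fixes g :: "real ^ 'n \<Rightarrow> real"
  assumes "convex_on UNIV g" and mid: "g (midpoint x y) = (g x + g y) / 2"
  shows "\<exists>v\<in>subdifferential g y. g x = g y + v \<bullet> (x - y)"
proof -
  define m where "m = midpoint x y"
  obtain v where v: "\<And>z. g m + v \<bullet> (z - m) \<le> g z"
    using convex_on_subgradient_exists[OF assms(1)] by blast
  have m: "v \<bullet> m = (v \<bullet> x + v \<bullet> y) / 2"
    by (simp add: m_def midpoint_def inner_add_right)
  have gm: "g m = (g x + g y) / 2"
    using mid by (simp add: m_def)
  \<comment> \<open>The slacks of the subgradient inequality at \<open>x\<close> and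
    \<open>y\<close> are nonnegative and sum to zero by \<open>m\<close> and \<open>gm\<close>, so
    both vanish.\<close>
  have tight: "g y = g m + v \<bullet> (y - m)" "g x = g m + v \<bullet> (x - m)"
    using v[of x] v[of y] m gm unfolding inner_diff_right by argo+
  have "v \<in> subdifferential g y"
    using v tight(1) by (simp add: subdifferential_def inner_diff_right)
  moreover have "g x = g y + v \<bullet> (x - y)"
    using tight by (simp add: inner_diff_right)
  ultimately show ?thesis by blast
qed

theorem theorem1:
  fixes g :: "real ^ 'n \<Rightarrow> real" and S :: "(real ^ 'n) set" and xb :: "real ^ 'n"
  assumes "convex_on UNIV g"
    and "S = {x. g x \<le> 0}"
    and "S \<noteq> {}"
    and "xb \<notin> S"
  shows "(\<exists>v\<in>subdifferential g xb. supports_set v (subgradient_rhs g xb v) S) \<longleftrightarrow>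
         (\<exists>x0\<in>S. affine_fun_on {0..1} (\<lambda>t. g (x0 + t *\<^sub>R (xb - x0))))"
proof
  assume "\<exists>v\<in>subdifferential g xb. supports_set v (subgradient_rhs g xb v) S"
  then obtain v x0 where v: "v \<in> subdifferential g xb" and x0: "x0 \<in> frontier S"
    and eq: "g xb + v \<bullet> (x0 - xb) = 0"
    by (auto simp: supports_set_def subgradient_rhs_def inner_diff_right)
  have "continuous_on UNIV g"
    using convex_on_continuous[OF open_UNIV assms(1)] .
  then have "closed S"
    unfolding assms(2) by (intro closed_Collect_le continuous_on_const)
  with x0 have "x0 \<in> S"
    using frontier_subset_closed by blast
  moreover have "g xb + v \<bullet> (x0 - xb) \<le> g x0"
    using v by (simp add: subdifferential_def)
  \<comment> \<open>Membership in \<open>S\<close> gives \<open>g x0 \<le> 0\<close>, the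
    subgradient bound gives \<open>0 \<le> g x0\<close>.\<close>
  ultimately have "g x0 = g xb + v \<bullet> (x0 - xb)"
    using eq assms(2) by simp
  from subgradient_tight_segment[OF assms(1) v this] \<open>x0 \<in> S\<close>
  show "\<exists>x0\<in>S. affine_fun_on {0..1} (\<lambda>t. g (x0 + t *\<^sub>R (xb - x0)))"
    unfolding affine_fun_on_def by (meson atLeastAtMost_iff)
next
  assume "\<exists>x0\<in>S. affine_fun_on {0..1} (\<lambda>t. g (x0 + t *\<^sub>R (xb - x0)))"
  then obtain x0 a b where "x0 \<in> S"
    and ab: "\<And>t. 0 \<le> t \<Longrightarrow> t \<le> 1 \<Longrightarrow> g (x0 + t *\<^sub>R (xb - x0)) = a * t + b"
    by (auto simp: affine_fun_on_def)
  have b: "b \<le> 0" using ab[of 0] \<open>x0 \<in> S\<close> assms(2) by simp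
  have gxb: "g xb = a + b" using ab[of 1] by simp
  then have pos: "a + b > 0" using assms(2,4) by simp
  then have "a > 0" using b by simp
  define p where "p t = x0 + t *\<^sub>R (xb - x0)" for t
  \<comment> \<open>The zero of the affine function; it lies in \<open>[0,1)\<close> since the end
    values satisfy \<open>b \<le> 0 < a + b\<close>.\<close>
  define t where "t = - b / a"
  have t: "0 \<le> t" "t < 1" "a * t + b = 0"
    using b pos \<open>a > 0\<close> by (auto simp: t_def field_simps)
  have gp: "g (p t) = 0"
    using ab[of t] t by (simp add: p_def)
  have front: "p t \<in> frontier S"
  proof -
    have "p t \<in> S" using gp assms(2) by simp
    moreover have "p t \<in> closure (- S)"
    proof -
      \<comment> \<open>Since \<open>a > 0\<close>, \<open>g\<close> is positive just beyond
        \<open>p t\<close> towards \<open>xb\<close>, so \<open>p t\<close> is a limit of points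
        outside \<open>S\<close>.\<close>
      have "p s \<in> - S" if "s \<in> {t<..<1}" for s
      proof -
        have "a * t < a * s" using that \<open>a > 0\<close> by simp
        then show ?thesis using ab[of s] that t assms(2) by (simp add: p_def)
      qed
      then have sub: "p ` {t<..<1} \<subseteq> closure (- S)"
        using closure_subset by fastforce
      have "continuous_on (closure {t<..<1}) p"
        unfolding p_def by (intro continuous_intros)
      from image_closure_subset[OF this closed_closure sub] show ?thesis
        using t by auto
    qed
    ultimately show ?thesis
      using closure_subset by (auto simp: frontier_closures)
  qed
  \<comment> \<open>The parameter \<open>(1 + t) / 2\<close> is the mean of those of
    \<open>p t\<close> and \<open>xb\<close>, so affinity makes the value there the mean of the end
    values.\<close>
  have "midpoint (p t) xb = p ((1 + t) / 2)"
    by (simp add: midpoint_def p_def vec_eq_iff field_simps)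
  then have "g (midpoint (p t) xb) = (g (p t) + g xb) / 2"
    using ab[of "(1 + t) / 2", folded p_def] t gp gxb by (simp add: field_simps)
  then obtain v where v: "v \<in> subdifferential g xb" "g (p t) = g xb + v \<bullet> (p t - xb)"
    using subgradient_tight_of_midpoint[OF assms(1)] by blast
  have "valid_ineq v (subgradient_rhs g xb v) S"
    unfolding valid_ineq_def subgradient_ineq_iff
    using v(1) assms(2) by (auto simp: subdifferential_def intro: order_trans)
  moreover have "v \<bullet> p t = subgradient_rhs g xb v"
    using v(2) gp by (simp add: subgradient_rhs_def inner_diff_right)
  ultimately show "\<exists>v\<in>subdifferential g xb. supports_set v (subgradient_rhs g xb v) S"
    using v(1) front by (auto simp: supports_set_def)
qed

end
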